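(* Let $n_1,\dots,n_k$ be positive integers with $n_1+\cdots+n_k=n$. Let $C$ be an $n\times n$ complex positive definite matrix and let $D=D_1\oplus\cdots\oplus D_k$, where each $D_i$ is an $n_i\times n_i$ complex positive definite matrix. Partition $C$ into blocks according to $(n_1,\dots,n_k)$, and let $C_1,\dots,C_k$ (with $C_i$ of size $n_i\times n_i$) be its diagonal blocks, so that the main block diagonal of $C$ is $C_1\oplus\cdots\oplus C_k$. Then $$\lambda\left(C_1^{-1}D_1\oplus\cdots\oplus C_k^{-1}D_k\right)\prec_{w\,\log}\lambda\left(C^{-1}D\right).$$
   Context: Positive definite matrices are Hermitian. For an $n\times n$ complex matrix $A$, $\lambda(A)$ denotes the vector of its $n$ eigenvalues, counted with algebraic multiplicity; a product of two positive definite matrices has positive real eigenvalues, so both vectors in the claim have positive real entries. For $x\in\mathbb{R}^n$, $x_{[1]}\ge x_{[2]}\ge\cdots\ge x_{[n]}$ denote the components of $x$ rearranged in non-increasing order. For $x,y\in\mathbb{R}^n$ with positive entries, $x\prec_{w\,\log}y$ ($x$ is weakly log-majorized by $y$) means $\prod_{i=1}^{l}x_{[i]}\le\prod_{i=1}^{l}y_{[i]}$ for all $l=1,\dots,n$. The symbol $\oplus$ denotes the block diagonal direct sum of matrices. *)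

theory Defs
  imports
    "HOL-Computational_Algebra.Computational_Algebra"
    "Jordan_Normal_Form.Schur_Decomposition"
    "Jordan_Normal_Form.Gauss_Jordan_Elimination"
begin

definition hermitian_mat :: "complex mat \<Rightarrow> bool" where
  "hermitian_mat A \<longleftrightarrow> square_mat A \<and> mat_adjoint A = A"

text \<open>For a Hermitian matrix the value of the quadratic form is real, so comparing its real part
  with 0 loses nothing.\<close>

definition pos_def_mat :: "complex mat \<Rightarrow> bool" where
  "pos_def_mat A \<longleftrightarrow> hermitian_mat A \<and>
     (\<forall>v \<in> carrier_vec (dim_row A). v \<noteq> 0\<^sub>v (dim_row A) \<longrightarrow> 0 < Re ((A *\<^sub>v v) \<bullet>c v))"

text \<open>Only meaningful for invertible matrices; positive definite matrices are invertible.\<close>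

definition mat_inv :: "complex mat \<Rightarrow> complex mat" where
  "mat_inv A = the (mat_inverse A)"

text \<open>The \<open>i\<close>-th diagonal block (\<open>i\<close> counted from 0) of a matrix partitioned according to the
  block sizes \<open>ns\<close>.\<close>

definition diag_block :: "nat list \<Rightarrow> complex mat \<Rightarrow> nat \<Rightarrow> complex mat" where
  "diag_block ns A i =
     (let s = sum_list (take i ns)
      in mat (ns ! i) (ns ! i) (\<lambda>(r, c). A $$ (s + r, s + c)))"

definition eigvals :: "complex mat \<Rightarrow> complex multiset" where
  "eigvals A = proots (char_poly A)"

text \<open>The vector of eigenvalues, here listed in non-decreasing order, of a matrix whose eigenvalues
  are all real. Taking real parts is meant only as the passage from complex to real numbers: a use
  of \<open>eigval_vec A\<close> has to be accompanied by \<open>set_mset (eigvals A) \<subseteq> \<real>\<close>.\<close>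

definition eigval_vec :: "complex mat \<Rightarrow> real list" where
  "eigval_vec A = sorted_list_of_multiset (image_mset Re (eigvals A))"

lemma length_eigval_vec:
  assumes "A \<in> carrier_mat n n"
  shows "length (eigval_vec A) = n"
  using degree_monic_char_poly[OF assms]
  by (metis eigval_vec_def eigvals_def mset_sorted_list_of_multiset size_image_mset size_mset
      size_proots_complex)

text \<open>\<open>decr x ! i\<close> is the \<open>(i+1)\<close>-th largest component of \<open>x\<close>.\<close>

definition decr :: "real list \<Rightarrow> real list" where
  "decr x = rev (sort x)"

definition weak_log_majorized :: "real list \<Rightarrow> real list \<Rightarrow> bool" (infix \<open>\<prec>\<^sub>w\<^sub>l\<^sub>o\<^sub>g\<close> 50) where
  "x \<prec>\<^sub>w\<^sub>l\<^sub>o\<^sub>g y \<longleftrightarrow>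
     length x = length y \<and> (\<forall>a \<in> set x. 0 < a) \<and> (\<forall>b \<in> set y. 0 < b) \<and>
     (\<forall>l \<in> {1..length x}. (\<Prod>i<l. decr x ! i) \<le> (\<Prod>i<l. decr y ! i))"

end

theory Submission
  imports
    Defs
    "Jordan_Normal_Form.Spectral_Radius"
    "HOL-Combinatorics.Permutations"
begin

text \<open>
  The proof rests on Schur's observation that the diagonal of a Hermitian matrix is a
  doubly stochastic average of its eigenvalues.

  Let \<open>C\<^sub>0 = C\<^sub>1 \<oplus> \<dots> \<oplus> C\<^sub>k\<close>. Diagonalizing each pair \<open>C\<^sub>i\<close>, \<open>D\<^sub>i\<close> by a congruence
  and taking the direct sum gives a block diagonal \<open>W\<close> with \<open>W\<^sup>* D W = I\<close> and \<open>W\<^sup>* C\<^sub>0 W\<close>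
  diagonal, with positive entries \<open>a\<^sub>1, \<dots>, a\<^sub>n\<close>. Then \<open>C\<^sub>0\<^sup>-\<^sup>1 D\<close> is similar to the diagonal
  matrix of the \<open>1 / a\<^sub>i\<close>. Because \<open>W\<close> is block diagonal, the \<open>a\<^sub>i\<close> are also the diagonal entries
  of \<open>W\<^sup>* C W\<close> (lemma \<open>blockwise_diagonalization\<close>). In the same way \<open>V\<^sup>* D V = I\<close> and
  \<open>V\<^sup>* C V\<close> is diagonal with entries \<open>b\<^sub>j\<close> for some \<open>V\<close>, and the eigenvalues of \<open>C\<^sup>-\<^sup>1 D\<close> are
  the \<open>1 / b\<^sub>j\<close> (lemmas \<open>pos_def_simultaneous_diagonalization\<close> and
  \<open>inverse_pencil_diagonalized\<close>).

  The matrix \<open>U = V\<^sup>-\<^sup>1 W\<close> is unitary and \<open>W\<^sup>* C W = U\<^sup>* (V\<^sup>* C V) U\<close>, so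
  \<open>a\<^sub>i\<close> is the sum over \<open>j\<close> of \<open>\<bar>U\<^sub>j\<^sub>i\<bar>\<^sup>2 b\<^sub>j\<close> with doubly stochastic weights. Since the
  logarithm is concave, \<open>ln (1 / a\<^sub>i)\<close> is at most the same average of the \<open>ln (1 / b\<^sub>j)\<close>, and a
  sum of \<open>l\<close> such averages is at most the sum of the \<open>l\<close> largest \<open>ln (1 / b\<^sub>j)\<close>
  (lemma \<open>weak_log_majorized_doubly_stochastic\<close>).
\<close>

section \<open>Adjoints and congruence\<close>

lemma adjoint_carrier [simp]: "A \<in> carrier_mat n m \<Longrightarrow> mat_adjoint A \<in> carrier_mat m n"
  unfolding mat_adjoint_def by (auto simp: mat_of_rows_def)

lemma adjoint_dim [simp]: "dim_row (mat_adjoint A) = dim_col A" "dim_col (mat_adjoint A) = dim_row A"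
  using adjoint_carrier[of A "dim_row A" "dim_col A"] by (auto simp del: adjoint_carrier)

lemma adjoint_index [simp]:
  "i < dim_col A \<Longrightarrow> j < dim_row A \<Longrightarrow> mat_adjoint A $$ (i,j) = conjugate (A $$ (j,i))"
  unfolding mat_adjoint_def by (auto simp: mat_of_rows_def)

lemma adjoint_adjoint [simp]: "mat_adjoint (mat_adjoint A) = A"
  by (rule eq_matI) auto

lemma adjoint_zero [simp]: "mat_adjoint (0\<^sub>m a b :: complex mat) = 0\<^sub>m b a"
  by (intro eq_matI) auto

lemma adjoint_mult:
  assumes "A \<in> carrier_mat n m" "B \<in> carrier_mat m k"
  shows "mat_adjoint (A * B) = mat_adjoint B * mat_adjoint A"
  using assms
  by (intro eq_matI) (auto simp: scalar_prod_def sum_conjugate conjugate_dist_mul mult.commute)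

lemma adjoint_four_block:
  assumes "A \<in> carrier_mat n1 m1" "B \<in> carrier_mat n1 m2" "C \<in> carrier_mat n2 m1" "D \<in> carrier_mat n2 m2"
  shows "mat_adjoint (four_block_mat A B C D) =
    four_block_mat (mat_adjoint A) (mat_adjoint C) (mat_adjoint B) (mat_adjoint D)"
  using assms by (intro eq_matI) auto

text \<open>The adjoint moves a matrix across the inner product; this turns the quadratic form of
  \<open>P\<^sup>* A P\<close> at \<open>x\<close> into that of \<open>A\<close> at \<open>P x\<close>.\<close>

lemma adjoint_cscalar_prod:
  assumes "P \<in> carrier_mat n m" "u \<in> carrier_vec n" "x \<in> carrier_vec m"
  shows "(mat_adjoint P *\<^sub>v u) \<bullet>c x = u \<bullet>c (P *\<^sub>v x)"
proof -
  have "(mat_adjoint P *\<^sub>v u) \<bullet>c x = (\<Sum>i<m. \<Sum>j<n. conjugate (P $$ (j,i)) * u $ j * conjugate (x $ i))"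
    using assms by (auto simp: scalar_prod_def sum_distrib_right atLeast0LessThan intro!: sum.cong)
  also have "\<dots> = (\<Sum>j<n. \<Sum>i<m. conjugate (P $$ (j,i)) * u $ j * conjugate (x $ i))"
    by (rule sum.swap)
  also have "\<dots> = u \<bullet>c (P *\<^sub>v x)"
    using assms by (auto simp: scalar_prod_def sum_distrib_left sum_conjugate atLeast0LessThan
        conjugate_dist_mul mult_ac intro!: sum.cong)
  finally show ?thesis .
qed

lemma adjoint_congruence:
  assumes "A \<in> carrier_mat n n" "P \<in> carrier_mat n m" "mat_adjoint A = A"
  shows "mat_adjoint (mat_adjoint P * A * P) = mat_adjoint P * A * P"
proof -
  have "mat_adjoint (mat_adjoint P * A * P) = mat_adjoint P * mat_adjoint (mat_adjoint P * A)"
    using assms by (intro adjoint_mult[of _ m n]) auto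
  also have "mat_adjoint (mat_adjoint P * A) = A * P"
    using assms adjoint_mult[of "mat_adjoint P" m n A n] by auto
  finally show ?thesis using assms by (simp add: assoc_mult_mat[of _ m n _ n _ m])
qed

text \<open>A congruence is a Gram matrix: its entries are the values of the sesquilinear form of \<open>A\<close> on the
  columns of \<open>P\<close>. Diagonalizing by congruence therefore means choosing columns orthogonal for that
  form.\<close>

lemma congruence_index:
  assumes "A \<in> carrier_mat n n" "P \<in> carrier_mat n m" "i < m" "j < m"
  shows "(mat_adjoint P * A * P) $$ (i,j) = (A *\<^sub>v col P j) \<bullet>c col P i"
proof -
  have "mat_adjoint P * A * P = mat_adjoint P * (A * P)"
    using assms by (auto intro!: assoc_mult_mat)
  also have "\<dots> $$ (i,j) = row (mat_adjoint P) i \<bullet> (A *\<^sub>v col P j)"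
    using assms col_mult2[of A n n P m j] by (subst index_mult_mat) (auto simp del: col_mult2)
  also have "row (mat_adjoint P) i = conjugate (col P i)"
    using assms by (intro eq_vecI) auto
  also have "conjugate (col P i) \<bullet> (A *\<^sub>v col P j) = (A *\<^sub>v col P j) \<bullet>c col P i"
    using assms by (intro comm_scalar_prod[of _ n]) auto
  finally show ?thesis .
qed

lemma congruence_mult:
  assumes Z: "Z \<in> carrier_mat n n" and P: "P \<in> carrier_mat n m" and Q: "Q \<in> carrier_mat m k"
  shows "mat_adjoint (P * Q) * Z * (P * Q) = mat_adjoint Q * (mat_adjoint P * Z * P) * Q"
proof -
  have P': "mat_adjoint P \<in> carrier_mat m n" and Q': "mat_adjoint Q \<in> carrier_mat k m"
    using P Q by auto
  have PZ: "mat_adjoint P * Z \<in> carrier_mat m n" using P' Z by auto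
  have "mat_adjoint (P * Q) * Z * (P * Q) = mat_adjoint Q * (mat_adjoint P * Z) * (P * Q)"
    using assoc_mult_mat[OF Q' P' Z] by (simp add: adjoint_mult[OF P Q])
  also have "\<dots> = mat_adjoint Q * (mat_adjoint P * Z) * P * Q"
    using assoc_mult_mat[OF _ P Q, of "mat_adjoint Q * (mat_adjoint P * Z)" k] Q' PZ by simp
  also have "mat_adjoint Q * (mat_adjoint P * Z) * P = mat_adjoint Q * (mat_adjoint P * Z * P)"
    by (rule assoc_mult_mat[OF Q' PZ P])
  finally show ?thesis .
qed

text \<open>A block diagonal congruence acts on each block separately. This is why the diagonal blocks of
  \<open>C\<close> alone determine the diagonal blocks of \<open>W\<^sup>* C W\<close> for block diagonal \<open>W\<close>.\<close>

lemma congruence_four_block_diag: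
  fixes A :: "complex mat"
  assumes "A \<in> carrier_mat n n" "E \<in> carrier_mat m m" "B \<in> carrier_mat n m" "C \<in> carrier_mat m n"
    and "P \<in> carrier_mat n n" "Q \<in> carrier_mat m m"
  shows "mat_adjoint (four_block_mat P (0\<^sub>m n m) (0\<^sub>m m n) Q) * four_block_mat A B C E *
     four_block_mat P (0\<^sub>m n m) (0\<^sub>m m n) Q =
     four_block_mat (mat_adjoint P * A * P) (mat_adjoint P * B * Q)
       (mat_adjoint Q * C * P) (mat_adjoint Q * E * Q)"
proof -
  let ?P = "four_block_mat P (0\<^sub>m n m) (0\<^sub>m m n) Q" and ?M = "four_block_mat A B C E"
  have "mat_adjoint ?P = four_block_mat (mat_adjoint P) (0\<^sub>m n m) (0\<^sub>m m n) (mat_adjoint Q)"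
    using assms by (simp add: adjoint_four_block[of _ n n _ m _ m])
  also have "\<dots> * ?M = four_block_mat (mat_adjoint P * A) (mat_adjoint P * B)
      (mat_adjoint Q * C) (mat_adjoint Q * E)"
    using assms by (subst mult_four_block_mat[of _ n n _ m _ m _ _ n _ m])
      (auto intro!: cong_four_block_mat left_add_zero_mat right_add_zero_mat mult_carrier_mat)
  also have "\<dots> * ?P = four_block_mat (mat_adjoint P * A * P) (mat_adjoint P * B * Q)
       (mat_adjoint Q * C * P) (mat_adjoint Q * E * Q)"
    using assms by (subst mult_four_block_mat[of _ n n _ m _ m _ _ n _ m])
      (auto intro!: cong_four_block_mat left_add_zero_mat right_add_zero_mat mult_carrier_mat)
  finally show ?thesis .
qed

section \<open>Positive definite matrices\<close>

lemma pos_def_mat_iff: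
  assumes "A \<in> carrier_mat n n"
  shows "pos_def_mat A \<longleftrightarrow> mat_adjoint A = A \<and>
    (\<forall>v \<in> carrier_vec n. v \<noteq> 0\<^sub>v n \<longrightarrow> 0 < Re ((A *\<^sub>v v) \<bullet>c v))"
  using assms unfolding pos_def_mat_def hermitian_mat_def by auto

lemma pos_def_congruence:
  assumes A: "A \<in> carrier_mat n n" "pos_def_mat A" and P: "P \<in> carrier_mat n m"
    and inj: "\<And>x. x \<in> carrier_vec m \<Longrightarrow> P *\<^sub>v x = 0\<^sub>v n \<Longrightarrow> x = 0\<^sub>v m"
  shows "pos_def_mat (mat_adjoint P * A * P)"
proof -
  have car: "mat_adjoint P * A * P \<in> carrier_mat m m" using A P by auto
  have "0 < Re (((mat_adjoint P * A * P) *\<^sub>v x) \<bullet>c x)" if x: "x \<in> carrier_vec m" "x \<noteq> 0\<^sub>v m" for x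
  proof -
    have Px: "P *\<^sub>v x \<in> carrier_vec n" using P x by auto
    have "(mat_adjoint P * A * P) *\<^sub>v x = mat_adjoint P *\<^sub>v (A *\<^sub>v (P *\<^sub>v x))"
      using A P x Px by (subst assoc_mult_mat_vec[of _ m n _ m]) (auto intro!: assoc_mult_mat_vec)
    hence "((mat_adjoint P * A * P) *\<^sub>v x) \<bullet>c x = (A *\<^sub>v (P *\<^sub>v x)) \<bullet>c (P *\<^sub>v x)"
      using A P x Px by (simp add: adjoint_cscalar_prod[of _ n m])
    thus ?thesis using A(2) Px inj x unfolding pos_def_mat_iff[OF A(1)] by auto
  qed
  thus ?thesis using A adjoint_congruence[OF A(1) P] unfolding pos_def_mat_iff[OF car] pos_def_mat_iff[OF A(1)]
    by auto
qed

lemma pos_def_diag: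
  assumes A: "A \<in> carrier_mat n n" and pd: "pos_def_mat A" and i: "i < n"
  shows "A $$ (i,i) = complex_of_real (Re (A $$ (i,i)))" "0 < Re (A $$ (i,i))"
proof -
  note pd' = pd[unfolded pos_def_mat_iff[OF A]]
  have "mat_adjoint A $$ (i,i) = A $$ (i,i)" using pd' by simp
  hence "cnj (A $$ (i,i)) = A $$ (i,i)" using A i by auto
  thus "A $$ (i,i) = complex_of_real (Re (A $$ (i,i)))" by (simp add: complex_eq_iff)
  have c: "conjugate (unit_vec n i) = (unit_vec n i :: complex vec)"
    by (rule eq_vecI) (auto simp: unit_vec_def)
  have "(A *\<^sub>v unit_vec n i) \<bullet>c unit_vec n i = A $$ (i,i)"
    using A i by (simp add: c scalar_prod_right_unit[of _ n])
  moreover have "unit_vec n i \<noteq> (0\<^sub>v n :: complex vec)" using i by (metis unit_vec_nonzero)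
  ultimately show "0 < Re (A $$ (i,i))" using pd' i by (metis unit_vec_carrier)
qed

text \<open>The kernel of \<open>A\<close> is trivial because the quadratic form vanishes on it, so the determinant is
  nonzero and Gauss-Jordan elimination succeeds.\<close>

lemma pos_def_inverse:
  assumes A: "A \<in> carrier_mat n n" and pd: "pos_def_mat A"
  shows "mat_inv A \<in> carrier_mat n n" "A * mat_inv A = 1\<^sub>m n" "mat_inv A * A = 1\<^sub>m n"
proof -
  have "det A \<noteq> 0"
  proof
    assume "det A = 0"
    then obtain v where v: "v \<in> carrier_vec n" "v \<noteq> 0\<^sub>v n" "A *\<^sub>v v = 0\<^sub>v n"
      using det_0_iff_vec_prod_zero[OF A] by auto
    hence "0 < Re ((A *\<^sub>v v) \<bullet>c v)" using pd unfolding pos_def_mat_iff[OF A] by blast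
    thus False using v by auto
  qed
  hence "A \<in> Units (ring_mat TYPE(complex) n ())" by (rule det_non_zero_imp_unit[OF A])
  then obtain B where B: "mat_inverse A = Some B"
    using mat_inverse(1)[OF A, of "()"] by (cases "mat_inverse A") auto
  from mat_inverse(2)[OF A B] B
  show "mat_inv A \<in> carrier_mat n n" "A * mat_inv A = 1\<^sub>m n" "mat_inv A * A = 1\<^sub>m n"
    by (auto simp: mat_inv_def)
qed

lemma hermitian_blocks:
  assumes A: "A \<in> carrier_mat n n" and B: "B \<in> carrier_mat n m" and C: "C \<in> carrier_mat m n"
    and E: "E \<in> carrier_mat m m"
    and h: "mat_adjoint (four_block_mat A B C E) = four_block_mat A B C E"
  shows "mat_adjoint A = A" "mat_adjoint E = E"
proof -
  have eq: "four_block_mat (mat_adjoint A) (mat_adjoint C) (mat_adjoint B) (mat_adjoint E) = four_block_mat A B C E"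
    using h adjoint_four_block[OF A B C E] by simp
  show "mat_adjoint A = A"
  proof (rule eq_matI)
    fix i j assume "i < dim_row A" "j < dim_col A"
    thus "mat_adjoint A $$ (i,j) = A $$ (i,j)" using A B C E
      arg_cong[OF eq, of "\<lambda>M. M $$ (i,j)"] by auto
  qed (use A in auto)
  show "mat_adjoint E = E"
  proof (rule eq_matI)
    fix i j assume "i < dim_row E" "j < dim_col E"
    thus "mat_adjoint E $$ (i,j) = E $$ (i,j)" using A B C E
      arg_cong[OF eq, of "\<lambda>M. M $$ (i+n,j+n)"] by auto
  qed (use E in auto)
qed

lemma conjugate_append: "conjugate (u @\<^sub>v v) = conjugate u @\<^sub>v conjugate v"
  by (rule eq_vecI) auto

text \<open>The quadratic form of a diagonal block is that of the whole matrix on vectors padded with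
  zeros.\<close>

lemma pos_def_blocks:
  assumes A: "A \<in> carrier_mat n n" and B: "B \<in> carrier_mat n m" and C: "C \<in> carrier_mat m n"
    and E: "E \<in> carrier_mat m m"
    and pd: "pos_def_mat (four_block_mat A B C E)"
  shows "pos_def_mat A" "pos_def_mat E"
proof -
  let ?M = "four_block_mat A B C E"
  have M: "?M \<in> carrier_mat (n+m) (n+m)" using A E by auto
  note pd' = pd[unfolded pos_def_mat_iff[OF M]]
  have form: "(?M *\<^sub>v (u @\<^sub>v w)) \<bullet>c (u @\<^sub>v w) =
     (A *\<^sub>v u + B *\<^sub>v w) \<bullet>c u + (C *\<^sub>v u + E *\<^sub>v w) \<bullet>c w"
    if "u \<in> carrier_vec n" "w \<in> carrier_vec m" for u w
    using that A B C E
    by (subst four_block_mat_mult_vec[OF A B C E], simp, simp)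
       (auto simp: conjugate_append intro!: scalar_prod_append[of _ n _ m])
  have pos: "0 < Re ((?M *\<^sub>v (u @\<^sub>v w)) \<bullet>c (u @\<^sub>v w))"
    if "u \<in> carrier_vec n" "w \<in> carrier_vec m" "u \<noteq> 0\<^sub>v n \<or> w \<noteq> 0\<^sub>v m" for u w
  proof -
    have "u @\<^sub>v w \<noteq> 0\<^sub>v (n+m)"
    proof
      assume "u @\<^sub>v w = 0\<^sub>v (n+m)"
      hence "u @\<^sub>v w = 0\<^sub>v n @\<^sub>v 0\<^sub>v m" by auto
      thus False using that append_vec_eq[of u n "0\<^sub>v n" w "0\<^sub>v m"] by auto
    qed
    thus ?thesis using pd' that by auto
  qed
  have zero: "X *\<^sub>v 0\<^sub>v c = 0\<^sub>v r" if "X \<in> carrier_mat r c" for X :: "complex mat" and r c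
    using that by (intro eq_vecI) auto
  have "0 < Re ((A *\<^sub>v u) \<bullet>c u)" if "u \<in> carrier_vec n" "u \<noteq> 0\<^sub>v n" for u
    using pos[of u "0\<^sub>v m"] form[of u "0\<^sub>v m"] that A B C E zero[OF B] by auto
  thus "pos_def_mat A" using hermitian_blocks[OF A B C E] pd' unfolding pos_def_mat_iff[OF A] by auto
  have "0 < Re ((E *\<^sub>v w) \<bullet>c w)" if "w \<in> carrier_vec m" "w \<noteq> 0\<^sub>v m" for w
    using pos[of "0\<^sub>v n" w] form[of "0\<^sub>v n" w] that A B C E zero[OF C] by auto
  thus "pos_def_mat E" using hermitian_blocks[OF A B C E] pd' unfolding pos_def_mat_iff[OF E] by auto
qed

lemma pos_def_diag_blocks:
  assumes A: "A \<in> carrier_mat n n" "pos_def_mat A" and E: "E \<in> carrier_mat m m" "pos_def_mat E"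
  shows "pos_def_mat (four_block_mat A (0\<^sub>m n m) (0\<^sub>m m n) E)" (is "pos_def_mat ?M")
proof -
  have M: "?M \<in> carrier_mat (n + m) (n + m)" using A E by auto
  note pdA = A(2)[unfolded pos_def_mat_iff[OF A(1)]] and pdE = E(2)[unfolded pos_def_mat_iff[OF E(1)]]
  have "mat_adjoint ?M = ?M"
    using pdA pdE adjoint_four_block[OF A(1) zero_carrier_mat zero_carrier_mat E(1)] by simp
  moreover have "0 < Re ((?M *\<^sub>v v) \<bullet>c v)" if v: "v \<in> carrier_vec (n + m)" "v \<noteq> 0\<^sub>v (n + m)" for v
  proof -
    define u w where "u = vec_first v n" and "w = vec_last v m"
    have uw: "u \<in> carrier_vec n" "w \<in> carrier_vec m" "v = u @\<^sub>v w"
      using v vec_first_last_append[of v n m] unfolding u_def w_def by auto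
    have "0\<^sub>m n m *\<^sub>v w = 0\<^sub>v n" "0\<^sub>m m n *\<^sub>v u = 0\<^sub>v m"
      using uw by auto
    hence "(?M *\<^sub>v v) \<bullet>c v = (A *\<^sub>v u) \<bullet>c u + (E *\<^sub>v w) \<bullet>c w"
      using uw A(1) E(1) unfolding uw(3) conjugate_append
      by (subst four_block_mat_mult_vec[OF A(1) zero_carrier_mat zero_carrier_mat E(1) uw(1,2)])
         (auto intro!: scalar_prod_append[of _ n _ m])
    moreover have "u \<noteq> 0\<^sub>v n \<or> w \<noteq> 0\<^sub>v m" using v uw by auto
    moreover have "0 < Re ((A *\<^sub>v u) \<bullet>c u)" if "u \<noteq> 0\<^sub>v n" using pdA uw that by auto
    moreover have "0 < Re ((E *\<^sub>v w) \<bullet>c w)" if "w \<noteq> 0\<^sub>v m" using pdE uw that by auto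
    moreover have "(A *\<^sub>v 0\<^sub>v n) \<bullet>c (0\<^sub>v n) = 0" "(E *\<^sub>v 0\<^sub>v m) \<bullet>c (0\<^sub>v m) = 0"
      using A(1) E(1) by auto
    ultimately show ?thesis
      by (cases "u = 0\<^sub>v n"; cases "w = 0\<^sub>v m") (auto intro: add_pos_pos)
  qed
  ultimately show ?thesis unfolding pos_def_mat_iff[OF M] by blast
qed

section \<open>Simultaneous diagonalization by congruence\<close>

text \<open>Gram-Schmidt applied to a basis that starts with \<open>u\<close>. The columns are orthogonal for the standard
  inner product but not normalized, so invertibility is recorded by a left inverse.\<close>

lemma exists_orthogonal_mat_first_col:
  fixes u :: "complex vec"
  assumes u: "u \<in> carrier_vec n" "u \<noteq> 0\<^sub>v n"
  shows "\<exists>X Y. X \<in> carrier_mat n n \<and> Y \<in> carrier_mat n n \<and> Y * X = 1\<^sub>m n \<and> col X 0 = u \<and>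
    (\<forall>i<n. \<forall>j<n. i \<noteq> j \<longrightarrow> col X i \<bullet>c col X j = 0)"
proof -
  interpret cof_vec_space n "TYPE(complex)" .
  define b where "b = basis_completion u"
  define ws where "ws = gram_schmidt n b"
  define X where "X = mat_of_cols n ws"
  have n: "n \<noteq> 0" using u by (metis carrier_vecD eq_vecI index_zero_vec(2) not_less_zero)
  from basis_completion[OF u, folded b_def]
  have dist_b: "distinct b" and indep: "\<not> lin_dep (set b)" and b: "set b \<subseteq> carrier_vec n"
    and hdb: "hd b = u" and len_b: "length b = n" by auto
  from hdb len_b n obtain vs where bv: "b = u # vs" by (cases b) auto
  from gram_schmidt_result[OF b dist_b indep refl, folded ws_def]
  have ws: "set ws \<subseteq> carrier_vec n" "corthogonal ws" "length ws = n" by (auto simp: len_b)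
  have hdws: "hd ws = u" using gram_schmidt_hd[OF u(1), of vs, folded bv] unfolding ws_def .
  have X: "X \<in> carrier_mat n n" using ws mat_of_cols_carrier(1)[of n ws] unfolding X_def by auto
  have orth: "corthogonal_mat X" using orthogonal_mat_of_cols ws unfolding X_def by auto
  have Y: "corthogonal_inv X \<in> carrier_mat n n"
    unfolding corthogonal_inv_def using X by (auto simp: mat_of_rows_def)
  have "corthogonal_inv X * X = 1\<^sub>m n"
    using corthogonal_inv_result[OF orth] X Y unfolding inverts_mat_def by auto
  moreover have "col X 0 = u" using hdws ws n unfolding X_def
    by (cases ws) (auto simp: col_mat_of_cols)
  moreover have "col X i \<bullet>c col X j = 0" if "i < n" "j < n" "i \<noteq> j" for i j
    using corthogonal_matD[OF orth, of i j] that X by auto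
  ultimately show ?thesis using X Y by blast
qed

text \<open>An eigenvector of \<open>D\<^sup>-\<^sup>1 C\<close>, which exists over the complex numbers, scaled to have length
  one for the form of \<open>D\<close>. The scaling needs the form to be real and positive at that vector.\<close>

lemma pencil_eigenvector:
  assumes C: "C \<in> carrier_mat n n" and D: "D \<in> carrier_mat n n" "pos_def_mat D" and n: "n > 0"
  shows "\<exists>v c. v \<in> carrier_vec n \<and> C *\<^sub>v v = c \<cdot>\<^sub>v (D *\<^sub>v v) \<and> (D *\<^sub>v v) \<bullet>c v = 1"
proof -
  note inv = pos_def_inverse[OF D]
  have A: "mat_inv D * C \<in> carrier_mat n n" using inv C by auto
  obtain c where "eigenvalue (mat_inv D * C) c"
    using spectrum_non_empty[OF A] n unfolding spectrum_def by auto
  then obtain x where x: "x \<in> carrier_vec n" "x \<noteq> 0\<^sub>v n" "(mat_inv D * C) *\<^sub>v x = c \<cdot>\<^sub>v x"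
    unfolding eigenvalue_def eigenvector_def using A by auto
  have "D *\<^sub>v (c \<cdot>\<^sub>v x) = (D * (mat_inv D * C)) *\<^sub>v x"
    using x A D assoc_mult_mat_vec[of D n n "mat_inv D * C" n x] by simp
  also have "D * (mat_inv D * C) = C"
    using inv C D assoc_mult_mat[of D n n "mat_inv D" n C n] by simp
  finally have Cx: "C *\<^sub>v x = c \<cdot>\<^sub>v (D *\<^sub>v x)" using D x by (simp add: mult_mat_vec)
  define q where "q = (D *\<^sub>v x) \<bullet>c x"
  note pd = D(2)[unfolded pos_def_mat_iff[OF D(1)]]
  have pos: "0 < Re q" using pd x unfolding q_def by auto
  have "q = x \<bullet>c (D *\<^sub>v x)"
    using adjoint_cscalar_prod[OF D(1) x(1) x(1)] pd unfolding q_def by simp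
  also have "\<dots> = cnj q"
    using conjugate_conjugate_sprod[of "D *\<^sub>v x" n x] conjugate_vec_sprod_comm[of x n "D *\<^sub>v x"]
      conjugate_vec_sprod_comm[of "D *\<^sub>v x" n x] D x unfolding q_def
    by (metis conjugate_complex_def mult_mat_vec_carrier conjugate_conjugate_sprod)
  finally have real: "q = complex_of_real (Re q)" by (simp add: complex_eq_iff)
  define s where "s = complex_of_real (1 / sqrt (Re q))"
  define v where "v = s \<cdot>\<^sub>v x"
  have v: "v \<in> carrier_vec n" using x unfolding v_def by auto
  have Dv: "D *\<^sub>v v = s \<cdot>\<^sub>v (D *\<^sub>v x)" using D x unfolding v_def by (simp add: mult_mat_vec)
  have Cv: "C *\<^sub>v v = c \<cdot>\<^sub>v (D *\<^sub>v v)"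
    using C x unfolding Dv by (simp add: v_def mult_mat_vec Cx smult_smult_assoc mult.commute)
  have "(D *\<^sub>v v) \<bullet>c v = s * cnj s * q"
    unfolding Dv unfolding v_def q_def using D x by (simp add: conjugate_smult_vec mult_ac)
  also have "\<dots> = 1" unfolding s_def
    by (subst real) (use pos in \<open>simp add: field_simps flip: of_real_mult of_real_divide\<close>)
  finally show ?thesis using v Cv by blast
qed

text \<open>By Hermitian symmetry the rest of the first row vanishes together with the rest of the first
  column.\<close>

lemma hermitian_border:
  fixes M :: "complex mat"
  assumes M: "M \<in> carrier_mat (Suc m) (Suc m)" and h: "mat_adjoint M = M"
    and z: "\<And>i. 0 < i \<Longrightarrow> i < Suc m \<Longrightarrow> M $$ (i,0) = 0"
  shows "\<exists>N \<in> carrier_mat m m.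
    M = four_block_mat (mat 1 1 (\<lambda>_. M $$ (0,0))) (0\<^sub>m 1 m) (0\<^sub>m m 1) N"
proof (intro bexI)
  have z': "M $$ (0,i) = 0" if "0 < i" "i < Suc m" for i
    using arg_cong[OF h, of "\<lambda>M. M $$ (0,i)"] z[OF that] that M by auto
  show "M = four_block_mat (mat 1 1 (\<lambda>_. M $$ (0,0))) (0\<^sub>m 1 m) (0\<^sub>m m 1)
     (mat m m (\<lambda>(i,j). M $$ (Suc i, Suc j)))"
    using M z z' by (intro eq_matI) auto
qed auto

lemma mat_diag_case_nat:
  "four_block_mat (mat 1 1 (\<lambda>_. c)) (0\<^sub>m 1 m) (0\<^sub>m m 1) (mat_diag m f) =
   mat_diag (Suc m) (case_nat c f)"
  by (intro eq_matI) (auto simp: mat_diag_def split: nat.split)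

text \<open>Induction on the size. Take \<open>v\<close> with \<open>C v = c D v\<close>. The vectors orthogonal to \<open>u = D v\<close>
  in the standard sense are those orthogonal to \<open>v\<close> for the form of \<open>D\<close>, and since \<open>C v\<close> is a
  multiple of \<open>u\<close> they are also orthogonal to \<open>v\<close> for the form of \<open>C\<close>. Hence replacing \<open>u\<close> by \<open>v\<close>
  in an orthogonal matrix with first column \<open>u\<close> gives a congruence that splits a
  one-dimensional block off both matrices at once, and the induction hypothesis applies to the
  remaining blocks.\<close>

lemma simultaneous_diagonalization:
  assumes "C \<in> carrier_mat n n" "mat_adjoint C = C" "D \<in> carrier_mat n n" "pos_def_mat D"
  shows "\<exists>W c. W \<in> carrier_mat n n \<and>
    mat_adjoint W * D * W = 1\<^sub>m n \<and> mat_adjoint W * C * W = mat_diag n c"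
  using assms
proof (induction n arbitrary: C D)
  case 0
  have "mat_adjoint (1\<^sub>m 0) * X * 1\<^sub>m 0 = (1\<^sub>m 0 :: complex mat)" if "X \<in> carrier_mat 0 0" for X
    using that by (intro eq_matI) auto
  moreover have "mat_diag 0 (\<lambda>_. 0) = (1\<^sub>m 0 :: complex mat)"
    by (intro eq_matI) (auto simp: mat_diag_def)
  ultimately show ?case using 0 by (intro exI[of _ "1\<^sub>m 0"] exI[of _ "\<lambda>_. 0"]) auto
next
  case (Suc m)
  let ?n = "Suc m"
  note C = Suc.prems(1,2) and D = Suc.prems(3,4)
  obtain v c where v: "v \<in> carrier_vec ?n" "C *\<^sub>v v = c \<cdot>\<^sub>v (D *\<^sub>v v)" "(D *\<^sub>v v) \<bullet>c v = 1"
    using pencil_eigenvector[OF C(1) D] by auto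
  define u where "u = D *\<^sub>v v"
  have u: "u \<in> carrier_vec ?n" using D v unfolding u_def by auto
  have u0: "u \<noteq> 0\<^sub>v ?n" using v unfolding u_def by auto
  obtain X Y where X: "X \<in> carrier_mat ?n ?n" and Y: "Y \<in> carrier_mat ?n ?n" and YX: "Y * X = 1\<^sub>m ?n"
    and X0: "col X 0 = u" and orth: "\<And>i j. i < ?n \<Longrightarrow> j < ?n \<Longrightarrow> i \<noteq> j \<Longrightarrow> col X i \<bullet>c col X j = 0"
    using exists_orthogonal_mat_first_col[OF u u0] by blast
  define P where "P = mat ?n ?n (\<lambda>(i,j). if j = 0 then v $ i else X $$ (i,j))"
  have P: "P \<in> carrier_mat ?n ?n" unfolding P_def by auto
  have P0: "col P 0 = v" using v unfolding P_def by (intro eq_vecI) auto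
  have Pj: "col P j = col X j" if "0 < j" "j < ?n" for j
    using that X unfolding P_def by (intro eq_vecI) auto
  have u_orth: "u \<bullet>c col P j = 0" if "0 < j" "j < ?n" for j
    using orth[of 0 j] that by (simp add: Pj X0)
  have inj: "x = 0\<^sub>v ?n" if x: "x \<in> carrier_vec ?n" "P *\<^sub>v x = 0\<^sub>v ?n" for x
  proof -
    \<comment> \<open>Pairing \<open>P x\<close> with \<open>u\<close> isolates the first coordinate of \<open>x\<close>; once that vanishes, \<open>P\<close> and
      \<open>X\<close> agree on \<open>x\<close> and the invertibility of \<open>X\<close> finishes.\<close>
    have Pu: "mat_adjoint P *\<^sub>v u = unit_vec ?n 0"
    proof (rule eq_vecI)
      fix j assume j: "j < dim_vec (unit_vec ?n 0 :: complex vec)"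
      have "(mat_adjoint P *\<^sub>v u) $ j = u \<bullet>c col P j"
        using j P u by (auto simp: scalar_prod_def mult.commute intro!: sum.cong)
      thus "(mat_adjoint P *\<^sub>v u) $ j = unit_vec ?n 0 $ j"
        using j u_orth[of j] v(3) by (cases "j = 0") (auto simp: P0 u_def)
    qed (use P in auto)
    have "cnj (x $ 0) = unit_vec ?n 0 \<bullet>c x"
      using x by (simp add: scalar_prod_left_unit[of _ ?n])
    also have "\<dots> = u \<bullet>c (P *\<^sub>v x)" using adjoint_cscalar_prod[OF P u x(1)] by (simp add: Pu)
    also have "\<dots> = 0" using x u by simp
    finally have x0: "x $ 0 = 0" by simp
    have "X *\<^sub>v x = P *\<^sub>v x"
      using X P x(1) x0
      by (intro eq_vecI) (auto simp: scalar_prod_def P_def simp del: sum.op_ivl_Suc intro!: sum.cong)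
    hence "Y *\<^sub>v (X *\<^sub>v x) = 0\<^sub>v ?n" using x Y by (auto intro!: eq_vecI)
    thus ?thesis using x X Y YX assoc_mult_mat_vec[OF Y X x(1)] by simp
  qed
  define G where "G = mat_adjoint P * D * P"
  define K where "K = mat_adjoint P * C * P"
  have G: "G \<in> carrier_mat ?n ?n" and K: "K \<in> carrier_mat ?n ?n" using P C D unfolding G_def K_def by auto
  have pdG: "pos_def_mat G" unfolding G_def by (rule pos_def_congruence[OF D P inj])
  have hG: "mat_adjoint G = G" using pdG G by (simp add: pos_def_mat_iff)
  have hK: "mat_adjoint K = K" unfolding K_def using adjoint_congruence[OF C(1) P C(2)] .
  have G00: "G $$ (0,0) = 1" using v(3) D P unfolding G_def by (subst congruence_index[OF D(1) P]) (auto simp: P0)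
  have Gi0: "G $$ (i,0) = 0" if "0 < i" "i < ?n" for i
    using u_orth[OF that] that unfolding G_def by (subst congruence_index[OF D(1) P]) (auto simp: P0 u_def)
  have Ki0: "K $$ (i,0) = 0" if "0 < i" "i < ?n" for i
    using u_orth[OF that] that u P unfolding K_def
    by (subst congruence_index[OF C(1) P]) (auto simp: P0 v(2) u_def[symmetric])
  define k where "k = K $$ (0,0)"
  obtain D2 where D2: "D2 \<in> carrier_mat m m"
    and G_eq: "G = four_block_mat (mat 1 1 (\<lambda>_. 1)) (0\<^sub>m 1 m) (0\<^sub>m m 1) D2"
    using hermitian_border[OF G hG Gi0] unfolding G00 by blast
  obtain C2 where C2: "C2 \<in> carrier_mat m m"
    and K_eq: "K = four_block_mat (mat 1 1 (\<lambda>_. k)) (0\<^sub>m 1 m) (0\<^sub>m m 1) C2"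
    using hermitian_border[OF K hK Ki0] unfolding k_def[symmetric] by blast
  have pdD2: "pos_def_mat D2"
    using pos_def_blocks(2)[of "mat 1 1 (\<lambda>_. 1)" 1 "0\<^sub>m 1 m" m "0\<^sub>m m 1" D2] pdG D2 unfolding G_eq by auto
  have hC2: "mat_adjoint C2 = C2"
    using hermitian_blocks(2)[of "mat 1 1 (\<lambda>_. k)" 1 "0\<^sub>m 1 m" m "0\<^sub>m m 1" C2] hK C2 unfolding K_eq by auto
  obtain W2 f where W2: "W2 \<in> carrier_mat m m"
    and WD: "mat_adjoint W2 * D2 * W2 = 1\<^sub>m m" and WC: "mat_adjoint W2 * C2 * W2 = mat_diag m f"
    using Suc.IH[OF C2 hC2 D2 pdD2] by blast
  define Q where "Q = four_block_mat (1\<^sub>m 1) (0\<^sub>m 1 m) (0\<^sub>m m 1) W2"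
  have Q: "Q \<in> carrier_mat ?n ?n" using W2 four_block_carrier_mat[of "1\<^sub>m 1" 1 1 W2 m m] unfolding Q_def by simp
  have one: "mat_adjoint (1\<^sub>m (Suc 0)) * mat (Suc 0) (Suc 0) (\<lambda>_. a) = mat (Suc 0) (Suc 0) (\<lambda>_. a)"
    for a :: complex
    by (intro eq_matI) (auto simp: scalar_prod_def)
  note PQ = congruence_mult[OF _ P Q]
  have "mat_adjoint (P * Q) * D * (P * Q) = mat_adjoint Q * G * Q" using PQ[OF D(1)] unfolding G_def .
  also have "\<dots> = four_block_mat (mat 1 1 (\<lambda>_. 1)) (0\<^sub>m 1 m) (0\<^sub>m m 1) (1\<^sub>m m)"
    unfolding Q_def G_eq using W2 D2
    by (subst congruence_four_block_diag) (auto simp: one WD intro!: cong_four_block_mat)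
  also have "\<dots> = 1\<^sub>m ?n" by (intro eq_matI) auto
  finally have 1: "mat_adjoint (P * Q) * D * (P * Q) = 1\<^sub>m ?n" .
  have "mat_adjoint (P * Q) * C * (P * Q) = mat_adjoint Q * K * Q" using PQ[OF C(1)] unfolding K_def .
  also have "\<dots> = mat_diag ?n (case_nat k f)"
    unfolding Q_def K_eq mat_diag_case_nat[symmetric] using W2 C2
    by (subst congruence_four_block_diag) (auto simp: one WC intro!: cong_four_block_mat)
  finally have 2: "mat_adjoint (P * Q) * C * (P * Q) = mat_diag ?n (case_nat k f)" .
  show ?case using 1 2 P Q by (intro exI[of _ "P * Q"] exI[of _ "case_nat k f"]) auto
qed

lemma pos_def_simultaneous_diagonalization:
  assumes C: "C \<in> carrier_mat n n" "pos_def_mat C" and D: "D \<in> carrier_mat n n" "pos_def_mat D"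
  shows "\<exists>W d. W \<in> carrier_mat n n \<and> mat_adjoint W * D * W = 1\<^sub>m n \<and>
    mat_adjoint W * C * W = mat_diag n (\<lambda>i. complex_of_real (d i)) \<and> (\<forall>i<n. 0 < d i)"
proof -
  have hC: "mat_adjoint C = C" using C by (simp add: pos_def_mat_iff)
  obtain W c where W: "W \<in> carrier_mat n n" and WD: "mat_adjoint W * D * W = 1\<^sub>m n"
    and WC: "mat_adjoint W * C * W = mat_diag n c"
    using simultaneous_diagonalization[OF C(1) hC D] by blast
  have inj: "x = 0\<^sub>v n" if x: "x \<in> carrier_vec n" "W *\<^sub>v x = 0\<^sub>v n" for x
  proof -
    have WD': "mat_adjoint W * D \<in> carrier_mat n n" using W D by auto
    have "x = (mat_adjoint W * D) *\<^sub>v (W *\<^sub>v x)"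
      using assoc_mult_mat_vec[OF WD' W x(1)] WD x by simp
    also have "\<dots> = 0\<^sub>v n" using WD' x(2) W D by (intro eq_vecI) auto
    finally show ?thesis .
  qed
  have pd: "pos_def_mat (mat_diag n c)"
    using pos_def_congruence[OF C W inj] unfolding WC .
  have c: "c i = complex_of_real (Re (c i))" "0 < Re (c i)" if "i < n" for i
    using pos_def_diag[OF mat_diag_dim pd that] that by (auto simp: mat_diag_def)
  have "mat_diag n c = mat_diag n (\<lambda>i. complex_of_real (Re (c i)))"
    using c(1) by (intro eq_matI) (auto simp: mat_diag_def)
  thus ?thesis using W WD WC c(2) by (intro exI[of _ W] exI[of _ "\<lambda>i. Re (c i)"]) simp
qed

text \<open>From \<open>W\<^sup>* D W = I\<close> one gets \<open>D W W\<^sup>* = I\<close>, so \<open>C W = D W (W\<^sup>* C W)\<close>, that is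
  \<open>C W = D W \<Delta>\<close> with \<open>\<Delta>\<close> the diagonal matrix of \<open>d\<close>. Multiplying by \<open>\<Delta>\<^sup>-\<^sup>1\<close> on the right and
  by \<open>C\<^sup>-\<^sup>1\<close> on the left gives the claim.\<close>

lemma inverse_pencil_diagonalized:
  assumes C: "C \<in> carrier_mat n n" "pos_def_mat C" and D: "D \<in> carrier_mat n n"
    and W: "W \<in> carrier_mat n n" and WD: "mat_adjoint W * D * W = 1\<^sub>m n"
    and WC: "mat_adjoint W * C * W = mat_diag n (\<lambda>i. complex_of_real (d i))"
    and d: "\<And>i. i < n \<Longrightarrow> d i \<noteq> 0"
  shows "mat_inv C * D * W = W * mat_diag n (\<lambda>i. complex_of_real (1 / d i))"
proof -
  let ?d = "mat_diag n (\<lambda>i. complex_of_real (d i))"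
  let ?e = "mat_diag n (\<lambda>i. complex_of_real (1 / d i))"
  note inv = pos_def_inverse[OF C]
  have W': "mat_adjoint W \<in> carrier_mat n n" using W by simp
  have DW: "D * W \<in> carrier_mat n n" and CW: "C * W \<in> carrier_mat n n" using C D W by auto
  have de: "?d * ?e = 1\<^sub>m n"
    using d by (simp only: mat_diag_diag) (intro eq_matI, auto simp: mat_diag_def)
  have "mat_adjoint W * (D * W) = 1\<^sub>m n" using assoc_mult_mat[OF W' D W] WD by simp
  hence DWW: "D * W * mat_adjoint W = 1\<^sub>m n" by (rule mat_mult_left_right_inverse[OF W' DW])
  have "C * W = D * W * mat_adjoint W * (C * W)" using left_mult_one_mat[OF CW] DWW by simp
  also have "\<dots> = D * W * ?d"
    using assoc_mult_mat[OF DW W' CW] assoc_mult_mat[OF W' C(1) W] WC by simp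
  finally have "C * W * ?e = D * W * (?d * ?e)"
    using assoc_mult_mat[OF DW mat_diag_dim mat_diag_dim] by simp
  hence "D * W = C * (W * ?e)"
    unfolding de using right_mult_one_mat[OF DW] assoc_mult_mat[OF C(1) W mat_diag_dim] by simp
  hence "mat_inv C * (D * W) = mat_inv C * C * (W * ?e)"
    using assoc_mult_mat[OF inv(1) C(1), of "W * ?e" n] W by simp
  thus ?thesis using inv assoc_mult_mat[OF inv(1) D W] W by simp
qed

section \<open>Block diagonal congruence\<close>

lemma diag_block_mat_carrier:
  assumes "length As = length ns" "\<And>i. i < length ns \<Longrightarrow> As ! i \<in> carrier_mat (ns ! i) (ns ! i)"
  shows "diag_block_mat As \<in> carrier_mat (sum_list ns) (sum_list ns)"
proof -
  have "dim_row (As ! i) = ns ! i" "dim_col (As ! i) = ns ! i" if "i < length ns" for i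
    using assms(2)[OF that] by auto
  hence "map dim_row As = ns" "map dim_col As = ns"
    using assms(1) by (auto intro!: nth_equalityI)
  thus ?thesis by (intro carrier_matI) (auto simp: dim_diag_block_mat)
qed

text \<open>Block \<open>i + 1\<close> of \<open>C\<close> is block \<open>i\<close> of the lower right corner that remains when the first block is
  split off; this is what makes induction on the list of block sizes work.\<close>

lemma diag_block_Cons:
  assumes "i < length ns"
  shows "diag_block (m # ns) C (Suc i) =
    diag_block ns (mat (sum_list ns) (sum_list ns) (\<lambda>(r,c). C $$ (m + r, m + c))) i"
proof -
  have "sum_list (take i ns) + ns ! i = sum_list (take (Suc i) ns)"
    using assms by (simp add: take_Suc_conv_app_nth)
  also have "\<dots> \<le> sum_list (take (Suc i) ns) + sum_list (drop (Suc i) ns)" by simp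
  also have "\<dots> = sum_list ns" by (metis append_take_drop_id sum_list_append)
  finally have "sum_list (take i ns) + ns ! i \<le> sum_list ns" .
  thus ?thesis by (auto simp: diag_block_def Let_def add.assoc intro!: eq_matI)
qed

lemma four_block_diag_mult:
  fixes A1 A2 :: "'a :: semiring_0 mat"
  assumes "A1 \<in> carrier_mat n n" "A2 \<in> carrier_mat n n" "B1 \<in> carrier_mat m m" "B2 \<in> carrier_mat m m"
  shows "four_block_mat A1 (0\<^sub>m n m) (0\<^sub>m m n) B1 * four_block_mat A2 (0\<^sub>m n m) (0\<^sub>m m n) B2 =
    four_block_mat (A1 * A2) (0\<^sub>m n m) (0\<^sub>m m n) (B1 * B2)"
  using assms by (subst mult_four_block_mat[of _ n n _ m _ m _ _ n _ m])
    (auto intro!: cong_four_block_mat left_add_zero_mat right_add_zero_mat mult_carrier_mat)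

lemma mat_diag_four_block:
  "four_block_mat (mat_diag n f) (0\<^sub>m n m) (0\<^sub>m m n) (mat_diag m g) =
   mat_diag (n + m) (\<lambda>i. if i < n then f i else g (i - n))"
  by (intro eq_matI) (auto simp: mat_diag_def)

text \<open>The columns of \<open>W\<close> can be chosen inside the blocks: each pair \<open>C\<^sub>i\<close>, \<open>D\<^sub>i\<close> is diagonalized by its
  own congruence \<open>W\<^sub>i\<close>, and \<open>W\<close> is the direct sum of the \<open>W\<^sub>i\<close>. The diagonal of \<open>W\<^sup>* C W\<close>
  then consists of the reciprocals of the eigenvalues of \<open>C\<^sub>1\<^sup>-\<^sup>1 D\<^sub>1 \<oplus> \<dots> \<oplus> C\<^sub>k\<^sup>-\<^sup>1 D\<^sub>k\<close>,
  although \<open>W\<^sup>* C W\<close> is not diagonal in general. The carrier and definiteness claims about the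
  direct sums are part of the conclusion because they come out of the same induction.\<close>

lemma blockwise_diagonalization:
  assumes "length Ds = length ns"
    and "\<And>i. i < length ns \<Longrightarrow> Ds ! i \<in> carrier_mat (ns ! i) (ns ! i)"
    and "\<And>i. i < length ns \<Longrightarrow> pos_def_mat (Ds ! i)"
    and "C \<in> carrier_mat (sum_list ns) (sum_list ns)" "pos_def_mat C"
  shows "\<exists>W d. W \<in> carrier_mat (sum_list ns) (sum_list ns) \<and>
    diag_block_mat Ds \<in> carrier_mat (sum_list ns) (sum_list ns) \<and> pos_def_mat (diag_block_mat Ds) \<and>
    diag_block_mat (map (\<lambda>i. mat_inv (diag_block ns C i) * Ds ! i) [0..<length ns])
      \<in> carrier_mat (sum_list ns) (sum_list ns) \<and>
    mat_adjoint W * diag_block_mat Ds * W = 1\<^sub>m (sum_list ns) \<and>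
    (\<forall>i < sum_list ns. 0 < d i \<and> (mat_adjoint W * C * W) $$ (i,i) = complex_of_real (d i)) \<and>
    diag_block_mat (map (\<lambda>i. mat_inv (diag_block ns C i) * Ds ! i) [0..<length ns]) * W =
      W * mat_diag (sum_list ns) (\<lambda>i. complex_of_real (1 / d i))"
  using assms
proof (induction ns arbitrary: Ds C)
  case Nil
  show ?case using Nil
    by (intro exI[of _ "1\<^sub>m 0"] exI[of _ "\<lambda>_. 1"])
       (auto simp: pos_def_mat_iff[of _ 0] intro!: eq_matI eq_vecI)
next
  case (Cons n ns)
  let ?m = "sum_list ns"
  obtain D1 Ds' where Ds: "Ds = D1 # Ds'" using Cons.prems(1) by (cases Ds) auto
  have D1: "D1 \<in> carrier_mat n n" "pos_def_mat D1"
    using Cons.prems(2,3)[of 0] by (auto simp: Ds)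
  have Ds': "length Ds' = length ns" "\<And>i. i < length ns \<Longrightarrow> Ds' ! i \<in> carrier_mat (ns ! i) (ns ! i)"
    "\<And>i. i < length ns \<Longrightarrow> pos_def_mat (Ds' ! i)"
    using Cons.prems(1) Cons.prems(2,3)[of "Suc i" for i] by (auto simp: Ds)
  have C: "C \<in> carrier_mat (n + ?m) (n + ?m)" using Cons.prems(4) by simp
  define A where "A = mat n n (\<lambda>(r,c). C $$ (r,c))"
  define B where "B = mat n ?m (\<lambda>(r,c). C $$ (r,n + c))"
  define B' where "B' = mat ?m n (\<lambda>(r,c). C $$ (n + r,c))"
  define E where "E = mat ?m ?m (\<lambda>(r,c). C $$ (n + r,n + c))"
  have car: "A \<in> carrier_mat n n" "B \<in> carrier_mat n ?m" "B' \<in> carrier_mat ?m n" "E \<in> carrier_mat ?m ?m"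
    unfolding A_def B_def B'_def E_def by auto
  have C_eq: "C = four_block_mat A B B' E"
    using C unfolding A_def B_def B'_def E_def by (intro eq_matI) auto
  note pd = pos_def_blocks[OF car, folded C_eq, OF Cons.prems(5)]
  obtain W1 d1 where W1: "W1 \<in> carrier_mat n n" and W1D: "mat_adjoint W1 * D1 * W1 = 1\<^sub>m n"
    and W1A: "mat_adjoint W1 * A * W1 = mat_diag n (\<lambda>i. complex_of_real (d1 i))"
    and d1: "\<And>i. i < n \<Longrightarrow> 0 < d1 i"
    using pos_def_simultaneous_diagonalization[OF car(1) pd(1) D1] by blast
  define L1 where "L1 = mat_inv A * D1"
  have L1: "L1 \<in> carrier_mat n n" unfolding L1_def using pos_def_inverse[OF car(1) pd(1)] D1 by auto
  have L1W: "L1 * W1 = W1 * mat_diag n (\<lambda>i. complex_of_real (1 / d1 i))"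
    unfolding L1_def using inverse_pencil_diagonalized[OF car(1) pd(1) D1(1) W1 W1D W1A] d1
    by (metis less_irrefl)
  define D2 where "D2 = diag_block_mat Ds'"
  define L2 where "L2 = diag_block_mat (map (\<lambda>i. mat_inv (diag_block ns E i) * Ds' ! i) [0..<length ns])"
  obtain W2 d2 where W2: "W2 \<in> carrier_mat ?m ?m" and D2: "D2 \<in> carrier_mat ?m ?m" "pos_def_mat D2"
    and L2: "L2 \<in> carrier_mat ?m ?m" and W2D: "mat_adjoint W2 * D2 * W2 = 1\<^sub>m ?m"
    and d2: "\<And>i. i < ?m \<Longrightarrow> 0 < d2 i"
    and W2E: "\<And>i. i < ?m \<Longrightarrow> (mat_adjoint W2 * E * W2) $$ (i,i) = complex_of_real (d2 i)"
    and L2W: "L2 * W2 = W2 * mat_diag ?m (\<lambda>i. complex_of_real (1 / d2 i))"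
    using Cons.IH[OF Ds' car(4) pd(2)] unfolding L2_def[symmetric] D2_def[symmetric] by blast
  let ?bd = "\<lambda>X Y. four_block_mat X (0\<^sub>m n ?m) (0\<^sub>m ?m n) Y"
  define d where "d i = (if i < n then d1 i else d2 (i - n))" for i
  define W where "W = ?bd W1 W2"
  have W: "W \<in> carrier_mat (n + ?m) (n + ?m)" unfolding W_def using W1 W2 by auto
  have D_eq: "diag_block_mat Ds = ?bd D1 D2" using D1 D2 by (simp add: Ds D2_def[symmetric] Let_def)
  have D: "diag_block_mat Ds \<in> carrier_mat (n + ?m) (n + ?m)" unfolding D_eq using D1 D2 by auto
  have L_eq: "diag_block_mat (map (\<lambda>i. mat_inv (diag_block (n # ns) C i) * Ds ! i) [0..<length (n # ns)]) = ?bd L1 L2"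
  proof -
    have "map (\<lambda>i. mat_inv (diag_block (n # ns) C i) * Ds ! i) [0..<length (n # ns)] =
      (mat_inv (diag_block (n # ns) C 0) * D1) #
      map (\<lambda>i. mat_inv (diag_block (n # ns) C (Suc i)) * Ds' ! i) [0..<length ns]"
      by (simp add: Ds map_upt_Suc del: upt_Suc)
    also have "diag_block (n # ns) C 0 = A" by (simp add: diag_block_def A_def)
    also have "map (\<lambda>i. mat_inv (diag_block (n # ns) C (Suc i)) * Ds' ! i) [0..<length ns] =
      map (\<lambda>i. mat_inv (diag_block ns E i) * Ds' ! i) [0..<length ns]"
      by (auto simp: diag_block_Cons E_def)
    finally show ?thesis using L1 L2 by (simp add: L1_def[symmetric] L2_def[symmetric] Let_def)
  qed
  have L: "?bd L1 L2 \<in> carrier_mat (n + ?m) (n + ?m)" using L1 L2 by auto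
  have z: "mat_adjoint X * 0\<^sub>m r c * Y = 0\<^sub>m r' c'"
    if "X \<in> carrier_mat r r'" "Y \<in> carrier_mat c c'" for X Y :: "complex mat" and r c r' c'
    using that by simp
  have WDW: "mat_adjoint W * diag_block_mat Ds * W = 1\<^sub>m (n + ?m)"
    unfolding W_def D_eq using congruence_four_block_diag[OF D1(1) D2(1) zero_carrier_mat zero_carrier_mat W1 W2]
    by (simp add: W1D W2D z[OF W1 W2] z[OF W2 W1])
  have WCW: "mat_adjoint W * C * W = four_block_mat (mat_adjoint W1 * A * W1) (mat_adjoint W1 * B * W2)
      (mat_adjoint W2 * B' * W1) (mat_adjoint W2 * E * W2)"
    unfolding W_def C_eq by (rule congruence_four_block_diag[OF car(1,4,2,3) W1 W2])
  have diag: "(mat_adjoint W * C * W) $$ (i,i) = complex_of_real (d i)" if i: "i < n + ?m" for i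
    using i W1 W2 W2E[of "i - n"] unfolding WCW W1A d_def by (auto simp: mat_diag_def)
  have LW: "?bd L1 L2 * W = W * mat_diag (n + ?m) (\<lambda>i. complex_of_real (1 / d i))"
  proof -
    have "?bd L1 L2 * W = ?bd (W1 * mat_diag n (\<lambda>i. complex_of_real (1 / d1 i)))
       (W2 * mat_diag ?m (\<lambda>i. complex_of_real (1 / d2 i)))"
      unfolding W_def four_block_diag_mult[OF L1 W1 L2 W2] L1W L2W ..
    also have "\<dots> = W * ?bd (mat_diag n (\<lambda>i. complex_of_real (1 / d1 i))) (mat_diag ?m (\<lambda>i. complex_of_real (1 / d2 i)))"
      unfolding W_def by (rule four_block_diag_mult[symmetric, OF W1 mat_diag_dim W2 mat_diag_dim])
    also have "?bd (mat_diag n (\<lambda>i. complex_of_real (1 / d1 i))) (mat_diag ?m (\<lambda>i. complex_of_real (1 / d2 i))) =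
      mat_diag (n + ?m) (\<lambda>i. complex_of_real (1 / d i))"
      unfolding mat_diag_four_block d_def by (rule arg_cong[of _ _ "mat_diag _"]) auto
    finally show ?thesis .
  qed
  have pdD: "pos_def_mat (?bd D1 D2)"
    by (rule pos_def_diag_blocks[OF D1 D2])
  have pos: "0 < d i" if "i < n + ?m" for i using that d1 d2[of "i - n"] unfolding d_def by auto
  show ?case unfolding L_eq sum_list.Cons
    using W D pdD L WDW pos diag LW D_eq by (intro exI[of _ W] exI[of _ d]) simp
qed

section \<open>Eigenvalues of a diagonalized matrix\<close>

lemma eigvals_diagonalized:
  assumes A: "A \<in> carrier_mat n n" and W: "W \<in> carrier_mat n n" and V: "V \<in> carrier_mat n n"
    and VW: "V * W = 1\<^sub>m n" and AW: "A * W = W * mat_diag n c"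
  shows "eigvals A = mset (map c [0..<n])"
proof -
  let ?M = "mat_diag n c"
  have WV: "W * V = 1\<^sub>m n" by (rule mat_mult_left_right_inverse[OF V W VW])
  have "A = A * (W * V)" using A WV by simp
  also have "\<dots> = W * ?M * V" using assoc_mult_mat[OF A W V] AW by simp
  finally have "similar_mat_wit A ?M W V"
    using A W V VW WV by (intro similar_mat_witI[of _ _ n]) auto
  hence "similar_mat A ?M" unfolding similar_mat_def by blast
  hence "char_poly A = char_poly ?M" by (rule char_poly_similar)
  also have "\<dots> = (\<Prod>a\<leftarrow>diag_mat ?M. [:- a, 1:])"
    by (rule char_poly_upper_triangular[of _ n]) (auto simp: mat_diag_def)
  also have "diag_mat ?M = map c [0..<n]" by (auto simp: diag_mat_def mat_diag_def)
  finally have "char_poly A = (\<Prod>a\<leftarrow>map c [0..<n]. [:- a, 1:])" .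
  moreover have "proots (\<Prod>a\<leftarrow>xs. [:- a, 1:]) = mset xs" for xs :: "complex list"
  proof (induction xs)
    case (Cons x xs)
    have "(\<Prod>a\<leftarrow>xs. [:- a, 1:]) \<noteq> 0" by (auto simp: prod_list_zero_iff)
    moreover have "proots [:- x, 1:] = {#x#}" by simp
    ultimately show ?case using Cons by (simp add: proots_mult del: mult_pCons_left)
  qed simp
  ultimately show ?thesis unfolding eigvals_def by (simp only:)
qed

section \<open>Doubly stochastic averages and log-majorization\<close>

text \<open>Weights in \<open>[0, 1]\<close> of total \<open>l\<close> give at most the sum of the \<open>l\<close> largest values: subtract the
  threshold \<open>t\<close>, the \<open>l\<close>-th largest value, from every \<open>z j\<close>. The terms above \<open>t\<close> are then
  nonnegative and grow when their weight is raised to 1, the others are nonpositive and grow when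
  their weight is lowered to 0, and the total weight makes the subtracted constants agree.\<close>

lemma sum_weights_le_sum_largest:
  fixes w z :: "nat \<Rightarrow> real"
  assumes dec: "\<And>i j. i \<le> j \<Longrightarrow> j < n \<Longrightarrow> z j \<le> z i"
    and w: "\<And>j. j < n \<Longrightarrow> 0 \<le> w j" "\<And>j. j < n \<Longrightarrow> w j \<le> 1"
    and sum: "(\<Sum>j<n. w j) = real l" and l: "l \<le> n"
  shows "(\<Sum>j<n. w j * z j) \<le> (\<Sum>j<l. z j)"
proof -
  \<comment> \<open>For \<open>l = 0\<close> truncated subtraction makes \<open>t\<close> the largest value, which still works.\<close>
  define t where "t = z (l - 1)"
  have "w j * (z j - t) \<le> (if j < l then z j - t else 0)" if j: "j < n" for j
  proof (cases "j < l")
    case True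
    hence "0 \<le> z j - t" using dec[of j "l - 1"] l unfolding t_def by auto
    thus ?thesis using True w(2)[OF j] mult_right_mono[of "w j" 1 "z j - t"] by simp
  next
    case False
    hence "z j - t \<le> 0" using dec[of "l - 1" j] j unfolding t_def by auto
    thus ?thesis using False w(1)[OF j] by (simp add: mult_nonneg_nonpos)
  qed
  hence "(\<Sum>j<n. w j * (z j - t)) \<le> (\<Sum>j<n. if j < l then z j - t else 0)"
    by (intro sum_mono) auto
  also have "\<dots> = (\<Sum>j\<in>{..<n} \<inter> {j. j < l}. z j - t)" by (simp add: sum.If_cases)
  also have "{..<n} \<inter> {j. j < l} = {..<l}" using l by auto
  also have "(\<Sum>j<l. z j - t) = (\<Sum>j<l. z j) - real l * t" by (simp add: sum_subtractf)
  also have "(\<Sum>j<n. w j * (z j - t)) = (\<Sum>j<n. w j * z j) - (\<Sum>j<n. w j) * t"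
    by (simp add: right_diff_distrib sum_subtractf sum_distrib_right)
  finally show ?thesis by (simp add: sum)
qed

text \<open>Jensen's inequality for the logarithm, obtained from the tangent bound \<open>ln t \<le> t - 1\<close> at
  \<open>t = x i / m\<close>, where \<open>m\<close> is the weighted mean.\<close>

lemma sum_ln_le_ln_sum:
  fixes s x :: "'a \<Rightarrow> real"
  assumes "finite I" "\<And>i. i \<in> I \<Longrightarrow> 0 \<le> s i" "(\<Sum>i\<in>I. s i) = 1" "\<And>i. i \<in> I \<Longrightarrow> 0 < x i"
  shows "(\<Sum>i\<in>I. s i * ln (x i)) \<le> ln (\<Sum>i\<in>I. s i * x i)"
proof -
  define m where "m = (\<Sum>i\<in>I. s i * x i)"
  have nonneg: "0 \<le> s i * x i" if "i \<in> I" for i using assms that by (simp add: less_imp_le)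
  obtain i where "i \<in> I" "s i \<noteq> 0" using assms(3) by (metis sum.neutral zero_neq_one)
  hence "0 < s i * x i" using assms by (simp add: order_less_le)
  hence m: "0 < m" unfolding m_def using \<open>i \<in> I\<close> assms(1) nonneg by (intro sum_pos2) auto
  have "s i * ln (x i) - s i * ln m \<le> s i * x i / m - s i" if i: "i \<in> I" for i
  proof -
    have "ln (x i) - ln m \<le> x i / m - 1"
      using ln_le_minus_one[of "x i / m"] m assms(4)[OF i] by (simp add: ln_div)
    from mult_left_mono[OF this assms(2)[OF i]] show ?thesis by (simp add: right_diff_distrib)
  qed
  hence "(\<Sum>i\<in>I. s i * ln (x i) - s i * ln m) \<le> (\<Sum>i\<in>I. s i * x i / m - s i)"
    by (rule sum_mono)
  also have "\<dots> = 0"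
    using m assms(3) by (simp add: sum_subtractf flip: sum_divide_distrib m_def)
  finally show ?thesis using assms(3)
    by (simp add: sum_subtractf m_def flip: sum_distrib_right)
qed

lemma decr_permutation:
  obtains p where "p permutes {..<length a}" "\<And>i. i < length a \<Longrightarrow> decr a ! i = a ! p i"
proof -
  obtain p where p: "p permutes {..<length a}" "permute_list p a = decr a"
    using mset_eq_permutation[of "decr a" a] unfolding decr_def by auto
  show ?thesis using that[OF p(1)] permute_list_nth[OF p(1)] p(2) by metis
qed

lemma decr_antimono: "i \<le> j \<Longrightarrow> j < length a \<Longrightarrow> decr a ! j \<le> decr a ! i"
  unfolding decr_def by (auto simp: rev_nth intro!: sorted_nth_mono)

text \<open>The analytic core. By Jensen, \<open>ln (1 / a i)\<close> is at most the \<open>s i\<close>-weighted mean of the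
  \<open>ln (1 / b j)\<close>. Summing over the \<open>l\<close> indices with the largest \<open>1 / a i\<close>, the weight that
  \<open>ln (1 / b j)\<close> receives is at most 1 because the sum over all \<open>i\<close> is 1, and the total weight is
  \<open>l\<close>; so the result is at most the sum of the \<open>l\<close> largest \<open>ln (1 / b j)\<close>.\<close>

lemma weak_log_majorized_doubly_stochastic:
  fixes a b :: "nat \<Rightarrow> real" and s :: "nat \<Rightarrow> nat \<Rightarrow> real"
  assumes a: "\<And>i. i < n \<Longrightarrow> 0 < a i" and b: "\<And>j. j < n \<Longrightarrow> 0 < b j"
    and s: "\<And>i j. i < n \<Longrightarrow> j < n \<Longrightarrow> 0 \<le> s i j"
    and row: "\<And>i. i < n \<Longrightarrow> (\<Sum>j<n. s i j) = 1" and col: "\<And>j. j < n \<Longrightarrow> (\<Sum>i<n. s i j) = 1"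
    and a_eq: "\<And>i. i < n \<Longrightarrow> a i = (\<Sum>j<n. s i j * b j)"
  shows "map (\<lambda>i. 1 / a i) [0..<n] \<prec>\<^sub>w\<^sub>l\<^sub>o\<^sub>g map (\<lambda>i. 1 / b i) [0..<n]" (is "?x \<prec>\<^sub>w\<^sub>l\<^sub>o\<^sub>g ?y")
proof -
  obtain p where p: "p permutes {..<n}" "\<And>i. i < n \<Longrightarrow> decr ?x ! i = ?x ! p i"
    using decr_permutation[of ?x] by auto
  obtain q where q: "q permutes {..<n}" "\<And>i. i < n \<Longrightarrow> decr ?y ! i = ?y ! q i"
    using decr_permutation[of ?y] by auto
  have pn: "p i < n" if "i < n" for i using permutes_in_image[OF p(1), of i] that by auto
  have qn: "q i < n" if "i < n" for i using permutes_in_image[OF q(1), of i] that by auto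
  have px: "decr ?x ! i = 1 / a (p i)" if "i < n" for i using p(2)[OF that] pn[OF that] by simp
  have qy: "decr ?y ! i = 1 / b (q i)" if "i < n" for i using q(2)[OF that] qn[OF that] by simp
  have main: "(\<Prod>i<l. decr ?x ! i) \<le> (\<Prod>i<l. decr ?y ! i)" if l: "l \<le> n" for l
  proof -
    \<comment> \<open>\<open>w j\<close> is the total weight that the \<open>l\<close> rows picked by \<open>p\<close> put on the \<open>j\<close>-th largest \<open>1 / b\<close>.\<close>
    define w where "w j = (\<Sum>i<l. s (p i) (q j))" for j
    define z where "z j = ln (decr ?y ! j)" for j
    have z: "z j = - ln (b (q j))" if "j < n" for j
      using qy[OF that] b[OF qn[OF that]] unfolding z_def by (simp add: ln_div)
    have "ln (decr ?x ! i) \<le> (\<Sum>j<n. s (p i) (q j) * z j)" if "i < n" for i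
    proof -
      have "(\<Sum>j<n. s (p i) j * ln (b j)) \<le> ln (a (p i))"
        unfolding a_eq[OF pn[OF that]] using s row b pn that by (intro sum_ln_le_ln_sum) auto
      moreover have "(\<Sum>j<n. s (p i) j * ln (b j)) = (\<Sum>j<n. s (p i) (q j) * ln (b (q j)))"
        using sum.permute[OF q(1)] by (simp add: comp_def)
      moreover have "\<dots> = - (\<Sum>j<n. s (p i) (q j) * z j)" by (simp add: z flip: sum_negf)
      ultimately show ?thesis using px[OF that] a[OF pn[OF that]] by (simp add: ln_div)
    qed
    hence "(\<Sum>i<l. ln (decr ?x ! i)) \<le> (\<Sum>i<l. \<Sum>j<n. s (p i) (q j) * z j)"
      using l by (intro sum_mono) auto
    also have "\<dots> = (\<Sum>j<n. w j * z j)"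
      unfolding w_def sum_distrib_right by (rule sum.swap)
    also have "\<dots> \<le> (\<Sum>j<l. z j)"
    proof (rule sum_weights_le_sum_largest)
      show "z j \<le> z i" if "i \<le> j" "j < n" for i j
        unfolding z_def using decr_antimono[of i j ?y] that qy[of i] qy[of j] b[OF qn] by auto
      show "0 \<le> w j" if "j < n" for j
        unfolding w_def using s pn qn that l by (intro sum_nonneg) auto
      show "w j \<le> 1" if "j < n" for j
      proof -
        have "w j \<le> (\<Sum>i<n. s (p i) (q j))"
          unfolding w_def using s pn qn that l by (intro sum_mono2) auto
        also have "\<dots> = (\<Sum>i<n. s i (q j))"
          using sum.permute[OF p(1), of "\<lambda>i. s i (q j)"] by (simp add: comp_def)
        finally show ?thesis using col[OF qn[OF that]] by simp
      qed
      have "(\<Sum>j<n. w j) = (\<Sum>i<l. \<Sum>j<n. s (p i) (q j))"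
        unfolding w_def by (rule sum.swap)
      also have "\<dots> = (\<Sum>i<l. 1)"
      proof (intro sum.cong refl)
        fix i assume "i \<in> {..<l}"
        thus "(\<Sum>j<n. s (p i) (q j)) = 1"
          using sum.permute[OF q(1), of "s (p i)"] row[OF pn[of i]] l by (simp add: comp_def)
      qed
      finally show "(\<Sum>j<n. w j) = real l" by simp
    qed (use l in auto)
    finally have le: "(\<Sum>i<l. ln (decr ?x ! i)) \<le> (\<Sum>i<l. ln (decr ?y ! i))" unfolding z_def .
    have posx: "0 < decr ?x ! i" if "i < l" for i using px[of i] a[OF pn] that l by auto
    have posy: "0 < decr ?y ! i" if "i < l" for i using qy[of i] b[OF qn] that l by auto
    have "ln (\<Prod>i<l. decr ?x ! i) \<le> ln (\<Prod>i<l. decr ?y ! i)"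
      using le posx posy by (subst (1 2) ln_prod) (auto simp: less_imp_neq[THEN not_sym])
    moreover have "0 < (\<Prod>i<l. decr ?x ! i)" "0 < (\<Prod>i<l. decr ?y ! i)"
      using posx posy by (auto intro!: prod_pos)
    ultimately show ?thesis by (simp only: ln_le_cancel_iff)
  qed
  show ?thesis unfolding weak_log_majorized_def using a b main by auto
qed

section \<open>Comparison of the two spectra\<close>

text \<open>For unitary \<open>U\<close> the diagonal of a Hermitian matrix is the average of its eigenvalues with
  weights \<open>\<bar>U\<^sub>j\<^sub>i\<bar>\<^sup>2\<close>; with \<open>f = 1\<close> the formula also shows that the weights sum to 1.\<close>

lemma diagonal_congruence_diagonal:
  assumes U: "U \<in> carrier_mat n n" and i: "i < n"
  shows "(mat_adjoint U * mat_diag n (\<lambda>j. complex_of_real (f j)) * U) $$ (i,i) =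
    complex_of_real (\<Sum>j<n. (cmod (U $$ (j,i)))\<^sup>2 * f j)"
proof -
  have "(mat_diag n (\<lambda>j. complex_of_real (f j)) *\<^sub>v col U i) $ j = complex_of_real (f j) * U $$ (j,i)"
    if j: "j < n" for j
  proof -
    have "(\<Sum>k\<in>{0..<n}. (if j = k then complex_of_real (f k) else 0) * U $$ (k,i)) =
      (\<Sum>k\<in>{0..<n}. if k = j then complex_of_real (f k) * U $$ (k,i) else 0)"
      by (intro sum.cong) auto
    thus ?thesis using U i j by (simp add: scalar_prod_def mat_diag_def)
  qed
  hence "(mat_adjoint U * mat_diag n (\<lambda>j. complex_of_real (f j)) * U) $$ (i,i) =
    (\<Sum>j<n. complex_of_real (f j) * U $$ (j,i) * cnj (U $$ (j,i)))"
    using U i by (subst congruence_index[OF mat_diag_dim U]) (auto simp: scalar_prod_def atLeast0LessThan)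
  also have "\<dots> = complex_of_real (\<Sum>j<n. (cmod (U $$ (j,i)))\<^sup>2 * f j)"
    by (simp add: complex_norm_square mult_ac del: of_real_power flip: of_real_power)
  finally show ?thesis .
qed

theorem theorem2p1:
  fixes ns :: "nat list" and n k :: nat and C D L R :: "complex mat" and Ds :: "complex mat list"
  assumes "1 \<le> k" and "length ns = k" and "\<And>i. i < k \<Longrightarrow> 0 < ns ! i" and "sum_list ns = n"
    and "C \<in> carrier_mat n n" and "pos_def_mat C"
    and "length Ds = k"
    and "\<And>i. i < k \<Longrightarrow> Ds ! i \<in> carrier_mat (ns ! i) (ns ! i)"
    and "\<And>i. i < k \<Longrightarrow> pos_def_mat (Ds ! i)"
    and "D = diag_block_mat Ds"
    and "L = diag_block_mat (map (\<lambda>i. mat_inv (diag_block ns C i) * Ds ! i) [0..<k])"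
    and "R = mat_inv C * D"
  shows "set_mset (eigvals L) \<subseteq> \<real> \<and> set_mset (eigvals R) \<subseteq> \<real> \<and> eigval_vec L \<prec>\<^sub>w\<^sub>l\<^sub>o\<^sub>g eigval_vec R"
proof -
  note C = assms(5,6)
  obtain W a where W: "W \<in> carrier_mat n n" and D: "D \<in> carrier_mat n n" "pos_def_mat D"
    and L: "L \<in> carrier_mat n n" and WD: "mat_adjoint W * D * W = 1\<^sub>m n"
    and a: "\<And>i. i < n \<Longrightarrow> 0 < a i"
    and WC: "\<And>i. i < n \<Longrightarrow> (mat_adjoint W * C * W) $$ (i,i) = complex_of_real (a i)"
    and LW: "L * W = W * mat_diag n (\<lambda>i. complex_of_real (1 / a i))"
    using blockwise_diagonalization[of Ds ns C] assms by blast
  obtain V b where V: "V \<in> carrier_mat n n" and VD: "mat_adjoint V * D * V = 1\<^sub>m n"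
    and VC: "mat_adjoint V * C * V = mat_diag n (\<lambda>i. complex_of_real (b i))"
    and b: "\<And>i. i < n \<Longrightarrow> 0 < b i"
    using pos_def_simultaneous_diagonalization[OF C D] by blast
  have R: "R \<in> carrier_mat n n" using pos_def_inverse[OF C] D assms(12) by auto
  have RV: "R * V = V * mat_diag n (\<lambda>i. complex_of_real (1 / b i))"
    unfolding assms(12) using inverse_pencil_diagonalized[OF C D(1) V VD VC] b by (metis less_irrefl)
  have VD': "mat_adjoint V * D \<in> carrier_mat n n" and WD': "mat_adjoint W * D \<in> carrier_mat n n"
    using V W D by auto
  \<comment> \<open>\<open>U\<close> is \<open>V\<^sup>-\<^sup>1 W\<close>. It is unitary because the columns of \<open>V\<close> and of \<open>W\<close> are both
    orthonormal for the form of \<open>D\<close>.\<close>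
  define U where "U = mat_adjoint V * D * W"
  have U: "U \<in> carrier_mat n n" unfolding U_def using VD' W by auto
  have U': "mat_adjoint U \<in> carrier_mat n n" using U by simp
  have "V * (mat_adjoint V * D) = 1\<^sub>m n" by (rule mat_mult_left_right_inverse[OF VD' V VD])
  hence W_eq: "W = V * U" unfolding U_def using assoc_mult_mat[OF V VD' W] W by simp
  have UU: "mat_adjoint U * U = 1\<^sub>m n"
    using WD congruence_mult[OF D(1) V U] right_mult_one_mat[OF U'] unfolding W_eq VD by simp
  have UU': "U * mat_adjoint U = 1\<^sub>m n" by (rule mat_mult_left_right_inverse[OF U' U UU])
  have UCU: "mat_adjoint W * C * W = mat_adjoint U * mat_diag n (\<lambda>i. complex_of_real (b i)) * U"
    unfolding W_eq VC[symmetric] by (rule congruence_mult[OF C(1) V U])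
  \<comment> \<open>The squared moduli of the entries of a unitary matrix are doubly stochastic.\<close>
  define s where "s i j = (cmod (U $$ (j,i)))\<^sup>2" for i j
  have "complex_of_real (a i) = complex_of_real (\<Sum>j<n. s i j * b j)" if "i < n" for i
    using WC[OF that] diagonal_congruence_diagonal[OF U that, of b] unfolding UCU s_def by simp
  hence a_eq: "a i = (\<Sum>j<n. s i j * b j)" if "i < n" for i using that of_real_eq_iff by blast
  have unit_norm: "(\<Sum>j<n. (cmod (Z $$ (j,i)))\<^sup>2) = 1"
    if Z: "Z \<in> carrier_mat n n" "mat_adjoint Z * Z = 1\<^sub>m n" and i: "i < n" for Z i
  proof -
    have Z': "mat_adjoint Z \<in> carrier_mat n n" using Z by simp
    have "mat_adjoint Z * mat_diag n (\<lambda>_. complex_of_real 1) * Z = 1\<^sub>m n"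
      using Z(2) right_mult_one_mat[OF Z'] by simp
    hence "complex_of_real (\<Sum>j<n. (cmod (Z $$ (j,i)))\<^sup>2 * 1) = 1\<^sub>m n $$ (i,i)"
      using diagonal_congruence_diagonal[OF Z(1) i, of "\<lambda>_. 1"] by (simp only:)
    also have "\<dots> = complex_of_real 1" using i by simp
    finally show ?thesis unfolding of_real_eq_iff by simp
  qed
  have row: "(\<Sum>j<n. s i j) = 1" if "i < n" for i
    using unit_norm[OF U UU that] unfolding s_def .
  have col: "(\<Sum>i<n. s i j) = 1" if "j < n" for j
  proof -
    have "(\<Sum>i<n. s i j) = (\<Sum>i<n. (cmod (mat_adjoint U $$ (i,j)))\<^sup>2)"
      using U that by (intro sum.cong) (auto simp: s_def)
    also have "\<dots> = 1" using unit_norm[OF U' _ that] UU' by simp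
    finally show ?thesis .
  qed
  have maj: "map (\<lambda>i. 1 / a i) [0..<n] \<prec>\<^sub>w\<^sub>l\<^sub>o\<^sub>g map (\<lambda>i. 1 / b i) [0..<n]"
    using a b row col a_eq by (intro weak_log_majorized_doubly_stochastic[where s = s]) (auto simp: s_def)
  have evL: "eigvals L = mset (map (\<lambda>i. complex_of_real (1 / a i)) [0..<n])"
    by (rule eigvals_diagonalized[OF L W WD' WD LW])
  have evR: "eigvals R = mset (map (\<lambda>i. complex_of_real (1 / b i)) [0..<n])"
    by (rule eigvals_diagonalized[OF R V VD' VD RV])
  have vec: "eigval_vec A = sort (map f [0..<n])"
    if "eigvals A = mset (map (\<lambda>i. complex_of_real (f i)) [0..<n])" for A f
  proof -
    have "image_mset Re (eigvals A) = mset (map f [0..<n])"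
      unfolding that by (simp flip: mset_map add: comp_def del: mset_map)
    thus ?thesis unfolding eigval_vec_def by (simp del: mset_map)
  qed
  \<comment> \<open>Majorization depends only on the multisets of components, so the sorting in
    \<open>eigval_vec\<close> is immaterial.\<close>
  have maj_sort: "sort x \<prec>\<^sub>w\<^sub>l\<^sub>o\<^sub>g sort y \<longleftrightarrow> x \<prec>\<^sub>w\<^sub>l\<^sub>o\<^sub>g y" for x y
    unfolding weak_log_majorized_def decr_def by (simp add: sorted_sort_id)
  have "eigval_vec L \<prec>\<^sub>w\<^sub>l\<^sub>o\<^sub>g eigval_vec R"
    using maj unfolding vec[OF evL] vec[OF evR] maj_sort .
  thus ?thesis unfolding evL evR by auto
qed

end
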